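(* Let $(\mathfrak{H},[\cdot,\cdot])$ be a Krein space with fundamental symmetry $J$, let $\mathcal{F}=\{f_n\}_{n\in\mathbb{N}}\subset\mathfrak{H}$ be a $J$-frame with frame bounds $0<A\le B$ and associated subspaces $\mathcal{M}_\pm$, and suppose that $\mathcal{D}:=\mathcal{M}_+\dot{+}\mathcal{M}_-\ne\mathfrak{H}$. Then $\mathcal{F}$ is a (conventional) frame in the Hilbert space $(\widehat{\mathfrak{H}},(\cdot,\cdot)_1)$ with the same frame bounds, i.e. $A\|f\|_1^2\le\sum_{n\in\mathbb{N}}|(f,f_n)_1|^2\le B\|f\|_1^2$ for all $f\in\widehat{\mathfrak{H}}$.
   Context: A Krein space $(\mathfrak{H},[\cdot,\cdot])$ is a complex (infinite-dimensional) linear space with an indefinite inner product admitting a fundamental decomposition $\mathfrak{H}=\mathfrak{H}_+[\dot{+}]\mathfrak{H}_-$, a $[\cdot,\cdot]$-orthogonal direct sum of Hilbert spaces $(\mathfrak{H}_+,[\cdot,\cdot])$ and $(\mathfrak{H}_-,-[\cdot,\cdot])$. A fundamental decomposition is fixed; its fundamental symmetry is $J(f_++f_-)=f_+-f_-$ ($f_\pm\in\mathfrak{H}_\pm$), and $(\cdot,\cdot)=[J\cdot,\cdot]$, $\|\cdot\|=\sqrt{(\cdot,\cdot)}$ is the associated Hilbert space inner product and norm. Subspaces are closed and topological notions refer to $\|\cdot\|$ unless stated otherwise. A subspace $\mathcal{L}$ is positive (negative) if $[f,f]>0$ ($[f,f]<0$) for all nonzero $f\in\mathcal{L}$, and maximal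 positive (negative) if it is not a proper subspace of another positive (negative) subspace. For $\mathcal{F}=\{f_n\}$ put $\mathbb{N}_+=\{n:[f_n,f_n]\ge0\}$, $\mathbb{N}_-=\{n:[f_n,f_n]<0\}$, $\mathcal{F}_\pm=\{f_n\}_{n\in\mathbb{N}_\pm}$, $\mathcal{M}_\pm=\overline{\mathrm{span}\,\mathcal{F}_\pm}$. $\mathcal{F}$ is a $J$-frame with frame bounds $0<A\le B$ if $\mathcal{M}_+$ is maximal positive, $\mathcal{M}_-$ is maximal negative, and $A|[f,f]|\le\sum_{n\in\mathbb{N}_+}|[f,f_n]|^2\le B|[f,f]|$ for all $f\in\mathrm{span}\,\mathcal{F}_+$, and $A|[f,f]|\le\sum_{n\in\mathbb{N}_-}|[f,f_n]|^2\le B|[f,f]|$ for all $f\in\mathrm{span}\,\mathcal{F}_-$. For $f=f_{\mathcal{M}_+}+f_{\mathcal{M}_-}$, $g=g_{\mathcal{M}_+}+g_{\mathcal{M}_-}$ in $\mathcal{D}$ (components in $\mathcal{M}_\pm$), $(f,g)_1:=[f_{\mathcal{M}_+},g_{\mathcal{M}_+}]-[f_{\mathcal{M}_-},g_{\mathcal{M}_-}]$, a positive definite inner product on $\mathcal{D}$. $(\widehat{\mathfrak{H}},(\cdot,\cdot)_1)$ is the Hilbert space completion of $\mathcal{D}$ with respect to $(\cdot,\cdot)_1$, and $\|f\|_1^2=(f,f)_1$. *)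

theory Defs
  imports "HOL-Analysis.Analysis"
begin

(* The distribution has no complex inner product spaces, so the scalar multiplication and the
   inner product are explicit parameters.  Inner products are linear in the first argument and
   antilinear in the second; no definiteness is assumed here. *)
locale hermitian_space = vector_space smul
  for smul :: "complex \<Rightarrow> 'a::ab_group_add \<Rightarrow> 'a" +
  fixes ip :: "'a \<Rightarrow> 'a \<Rightarrow> complex"
  assumes ip_add_left: "ip (x + y) z = ip x z + ip y z"
    and ip_scale_left: "ip (smul c x) y = c * ip x y"
    and ip_cnj_commute: "ip y x = cnj (ip x y)"

definition ip_norm :: "('a \<Rightarrow> 'a \<Rightarrow> complex) \<Rightarrow> 'a \<Rightarrow> real" where
  "ip_norm ip x = sqrt (Re (ip x x))"

definition ip_dist :: "('a::ab_group_add \<Rightarrow> 'a \<Rightarrow> complex) \<Rightarrow> 'a \<Rightarrow> 'a \<Rightarrow> real" where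
  "ip_dist ip x y = ip_norm ip (x - y)"

(* The linear subspace S, with ip restricted to it, is a Hilbert space in its own right; ip may be
   indefinite outside S. *)
definition hilbert_on ::
  "(complex \<Rightarrow> 'a::ab_group_add \<Rightarrow> 'a) \<Rightarrow> ('a \<Rightarrow> 'a \<Rightarrow> complex) \<Rightarrow> 'a set \<Rightarrow> bool" where
  "hilbert_on smul ip S \<longleftrightarrow>
     hermitian_space smul ip \<and> module.subspace smul S \<and>
     (\<forall>x\<in>S. x \<noteq> 0 \<longrightarrow> 0 < Re (ip x x)) \<and>
     Metric_space.mcomplete S (ip_dist ip)"

definition direct_sum :: "'a::ab_group_add set \<Rightarrow> 'a set \<Rightarrow> 'a set" where
  "direct_sum U V = {u + v | u v. u \<in> U \<and> v \<in> V}"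

(* The component in U of an element of U + V; meaningful when U and V meet only in 0. *)
definition component :: "'a::ab_group_add set \<Rightarrow> 'a set \<Rightarrow> 'a \<Rightarrow> 'a" where
  "component U V x = (THE u. u \<in> U \<and> x - u \<in> V)"

(* An infinite-dimensional Krein space with a fixed fundamental decomposition Hp, Hm. *)
locale krein_space = hermitian_space smul ip
  for smul :: "complex \<Rightarrow> 'a::ab_group_add \<Rightarrow> 'a" and ip :: "'a \<Rightarrow> 'a \<Rightarrow> complex" +
  fixes Hp Hm :: "'a set"
  assumes infinite_dimensional: "\<nexists>S. finite S \<and> module.span smul S = UNIV"
    and hilbert_Hp: "hilbert_on smul ip Hp"
    and hilbert_Hm: "hilbert_on smul (\<lambda>x y. - ip x y) Hm"
    and orthogonal: "\<And>x y. x \<in> Hp \<Longrightarrow> y \<in> Hm \<Longrightarrow> ip x y = 0"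
    and decomposition: "direct_sum Hp Hm = UNIV" "Hp \<inter> Hm = {0}"
begin

definition J :: "'a \<Rightarrow> 'a" where
  "J x = component Hp Hm x - component Hm Hp x"

definition ipJ :: "'a \<Rightarrow> 'a \<Rightarrow> complex" where
  "ipJ x y = ip (J x) y"

definition topJ :: "'a topology" where
  "topJ = Metric_space.mtopology UNIV (ip_dist ipJ)"

definition closed_subspace :: "'a set \<Rightarrow> bool" where
  "closed_subspace L \<longleftrightarrow> module.subspace smul L \<and> closedin topJ L"

definition positive :: "'a set \<Rightarrow> bool" where
  "positive L \<longleftrightarrow> closed_subspace L \<and> (\<forall>x\<in>L. x \<noteq> 0 \<longrightarrow> 0 < Re (ip x x))"

definition negative :: "'a set \<Rightarrow> bool" where
  "negative L \<longleftrightarrow> closed_subspace L \<and> (\<forall>x\<in>L. x \<noteq> 0 \<longrightarrow> Re (ip x x) < 0)"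

definition maximal_positive :: "'a set \<Rightarrow> bool" where
  "maximal_positive L \<longleftrightarrow> positive L \<and> (\<nexists>L'. positive L' \<and> L \<subset> L')"

definition maximal_negative :: "'a set \<Rightarrow> bool" where
  "maximal_negative L \<longleftrightarrow> negative L \<and> (\<nexists>L'. negative L' \<and> L \<subset> L')"

definition Np :: "(nat \<Rightarrow> 'a) \<Rightarrow> nat set" where
  "Np f = {n. 0 \<le> Re (ip (f n) (f n))}"

definition Nm :: "(nat \<Rightarrow> 'a) \<Rightarrow> nat set" where
  "Nm f = {n. Re (ip (f n) (f n)) < 0}"

definition Mp :: "(nat \<Rightarrow> 'a) \<Rightarrow> 'a set" where
  "Mp f = topJ closure_of module.span smul (f ` Np f)"

definition Mm :: "(nat \<Rightarrow> 'a) \<Rightarrow> 'a set" where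
  "Mm f = topJ closure_of module.span smul (f ` Nm f)"

(* infsum of a divergent series is 0, so convergence is demanded separately. *)
definition J_frame :: "(nat \<Rightarrow> 'a) \<Rightarrow> real \<Rightarrow> real \<Rightarrow> bool" where
  "J_frame f A B \<longleftrightarrow>
     0 < A \<and> A \<le> B \<and> maximal_positive (Mp f) \<and> maximal_negative (Mm f) \<and>
     (\<forall>x \<in> module.span smul (f ` Np f).
        (\<lambda>n. (cmod (ip x (f n)))\<^sup>2) summable_on Np f \<and>
        A * cmod (ip x x) \<le> (\<Sum>\<^sub>\<infinity>n\<in>Np f. (cmod (ip x (f n)))\<^sup>2) \<and>
        (\<Sum>\<^sub>\<infinity>n\<in>Np f. (cmod (ip x (f n)))\<^sup>2) \<le> B * cmod (ip x x)) \<and>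
     (\<forall>x \<in> module.span smul (f ` Nm f).
        (\<lambda>n. (cmod (ip x (f n)))\<^sup>2) summable_on Nm f \<and>
        A * cmod (ip x x) \<le> (\<Sum>\<^sub>\<infinity>n\<in>Nm f. (cmod (ip x (f n)))\<^sup>2) \<and>
        (\<Sum>\<^sub>\<infinity>n\<in>Nm f. (cmod (ip x (f n)))\<^sup>2) \<le> B * cmod (ip x x))"

definition D :: "(nat \<Rightarrow> 'a) \<Rightarrow> 'a set" where
  "D f = direct_sum (Mp f) (Mm f)"

definition ip1 :: "(nat \<Rightarrow> 'a) \<Rightarrow> 'a \<Rightarrow> 'a \<Rightarrow> complex" where
  "ip1 f x y =
     ip (component (Mp f) (Mm f) x) (component (Mp f) (Mm f) y)
     - ip (component (Mm f) (Mp f) x) (component (Mm f) (Mp f) y)"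

end

(* The whole type 'b, with smulH and ipH, is a Hilbert space, and emb embeds the inner product
   space (S, ip) linearly and isometrically onto a dense subspace of it. *)
definition hilbert_completion ::
  "(complex \<Rightarrow> 'a::ab_group_add \<Rightarrow> 'a) \<Rightarrow> 'a set \<Rightarrow> ('a \<Rightarrow> 'a \<Rightarrow> complex) \<Rightarrow>
   (complex \<Rightarrow> 'b::ab_group_add \<Rightarrow> 'b) \<Rightarrow> ('b \<Rightarrow> 'b \<Rightarrow> complex) \<Rightarrow> ('a \<Rightarrow> 'b) \<Rightarrow> bool" where
  "hilbert_completion smul S ip smulH ipH emb \<longleftrightarrow>
     hilbert_on smulH ipH UNIV \<and>
     (\<forall>x\<in>S. \<forall>y\<in>S. emb (x + y) = emb x + emb y) \<and>
     (\<forall>c. \<forall>x\<in>S. emb (smul c x) = smulH c (emb x)) \<and>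
     (\<forall>x\<in>S. \<forall>y\<in>S. ipH (emb x) (emb y) = ip x y) \<and>
     Metric_space.mtopology UNIV (ip_dist ipH) closure_of (emb ` S) = UNIV"

definition hilbert_frame ::
  "(complex \<Rightarrow> 'b::ab_group_add \<Rightarrow> 'b) \<Rightarrow> ('b \<Rightarrow> 'b \<Rightarrow> complex) \<Rightarrow> (nat \<Rightarrow> 'b) \<Rightarrow> real \<Rightarrow> real \<Rightarrow> bool"
  where
  "hilbert_frame smul ip f A B \<longleftrightarrow>
     hilbert_on smul ip UNIV \<and> 0 < A \<and> A \<le> B \<and>
     (\<forall>x. (\<lambda>n. (cmod (ip x (f n)))\<^sup>2) summable_on UNIV \<and>
        A * (ip_norm ip x)\<^sup>2 \<le> (\<Sum>\<^sub>\<infinity>n. (cmod (ip x (f n)))\<^sup>2) \<and>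
        (\<Sum>\<^sub>\<infinity>n. (cmod (ip x (f n)))\<^sup>2) \<le> B * (ip_norm ip x)\<^sup>2)"

end

theory Submission
  imports Defs
begin

text \<open>For \<open>x = x\<^sub>+ + x\<^sub>-\<close> with \<open>x\<^sub>\<plusminus>\<close> in the span of \<open>\<F>\<^sub>\<plusminus>\<close>, the number \<open>(x, f\<^sub>n)\<^sub>1\<close> is
  \<open>[x\<^sub>+, f\<^sub>n]\<close> or \<open>-[x\<^sub>-, f\<^sub>n]\<close> according to the sign of \<open>[f\<^sub>n, f\<^sub>n]\<close>, so the two \<open>J\<close>-frame
  inequalities add up to the frame inequality for \<open>x\<close>. Such \<open>x\<close> are dense in the completion.\<close>

section \<open>Square sums controlled by their finite partial sums\<close>

lemma L2_set_le_sqrt_infsum: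
  assumes "(\<lambda>n. (u n)\<^sup>2) summable_on UNIV" "finite F"
  shows "L2_set u F \<le> sqrt (\<Sum>\<^sub>\<infinity>n. (u n)\<^sup>2)"
  unfolding L2_set_def using finite_sum_le_infsum[OF assms(1,2)] by simp

text \<open>Minkowski's inequality bounds finite partial sums only. When the bound does not depend
  on the index set, monotone partial sums give both convergence and the bound on the limit.\<close>

lemma summable_on_L2_set_bound:
  fixes u :: "'i \<Rightarrow> real"
  assumes "\<And>F. finite F \<Longrightarrow> L2_set u F \<le> C"
  shows "(\<lambda>n. (u n)\<^sup>2) summable_on UNIV" "(\<Sum>\<^sub>\<infinity>n. (u n)\<^sup>2) \<le> C\<^sup>2"
proof -
  have le: "(\<Sum>n\<in>F. (u n)\<^sup>2) \<le> C\<^sup>2" if "finite F" for F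
    using power_mono[OF assms[OF that] L2_set_nonneg, of 2]
    by (simp add: L2_set_def sum_nonneg)
  show "(\<lambda>n. (u n)\<^sup>2) summable_on UNIV"
    by (rule nonneg_bdd_above_summable_on) (auto intro!: bdd_aboveI[of _ "C\<^sup>2"] le)
  then show "(\<Sum>\<^sub>\<infinity>n. (u n)\<^sup>2) \<le> C\<^sup>2"
    by (rule infsum_le_finite_sums) (use le in auto)
qed

section \<open>Hermitian forms without definiteness, and components in direct sums\<close>

context hermitian_space
begin

lemma ip_zero_left [simp]: "ip 0 y = 0"
  using ip_add_left[of 0 0 y] by simp

lemma ip_minus_left: "ip (- x) y = - ip x y"
  using ip_add_left[of x "- x" y] by (simp add: eq_neg_iff_add_eq_0 add.commute)

lemma ip_diff_left: "ip (x - y) z = ip x z - ip y z"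
  using ip_add_left[of x "- y" z] by (simp add: ip_minus_left)

lemma ip_add_right: "ip z (x + y) = ip z x + ip z y"
  by (metis complex_cnj_add ip_add_left ip_cnj_commute)

lemma ip_scale_right: "ip x (smul c y) = cnj c * ip x y"
  by (metis complex_cnj_mult ip_scale_left ip_cnj_commute)

lemma ip_zero_right [simp]: "ip y 0 = 0"
  by (metis complex_cnj_zero ip_cnj_commute ip_zero_left)

lemma ip_minus_right: "ip y (- x) = - ip y x"
  by (metis complex_cnj_minus ip_cnj_commute ip_minus_left)

lemma ip_diff_right: "ip z (x - y) = ip z x - ip z y"
  by (metis complex_cnj_diff ip_diff_left ip_cnj_commute)

lemma Im_ip_self [simp]: "Im (ip x x) = 0"
  using ip_cnj_commute[of x x] by (metis Reals_cnj_iff complex_is_Real_iff)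

lemma ip_self: "ip x x = of_real (Re (ip x x))"
  by (simp add: complex_eq_iff)

lemma cmod_ip_self: "cmod (ip x x) = \<bar>Re (ip x x)\<bar>"
  by (metis ip_self norm_of_real)

text \<open>Two candidates for the component differ by a vector of both \<open>U\<close> and
  \<open>V\<close>, hence by 0. This replaces the definite description by a computable
  value.\<close>

lemma component_eq:
  assumes "subspace U" "subspace V" "U \<inter> V = {0}" "u \<in> U" "v \<in> V"
  shows "component U V (u + v) = u"
  unfolding component_def
proof (rule the_equality)
  show "u \<in> U \<and> u + v - u \<in> V"
    using assms by simp
next
  fix w assume w: "w \<in> U \<and> u + v - w \<in> V"
  have "u - w \<in> U"
    using w assms by (simp add: subspace_diff)
  moreover have "u - w \<in> V"
    using w assms subspace_diff[of V "u + v - w" v] by (simp add: algebra_simps)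
  ultimately have "u - w = 0"
    using assms by blast
  then show "w = u"
    by simp
qed

lemma subspace_direct_sum:
  assumes "subspace U" "subspace V"
  shows "subspace (direct_sum U V)"
  using subspace_sums[OF assms] unfolding direct_sum_def by simp

end

section \<open>Positive definite forms: norm, metric and density\<close>

locale definite_hermitian_space = hermitian_space +
  assumes ip_pos: "x \<noteq> 0 \<Longrightarrow> 0 < Re (ip x x)"
begin

lemma ip_nonneg: "0 \<le> Re (ip x x)"
  using ip_pos[of x] by (cases "x = 0") auto

lemma ip_norm_nonneg [simp]: "0 \<le> ip_norm ip x"
  by (simp add: ip_norm_def ip_nonneg)

lemma ip_norm_power2: "(ip_norm ip x)\<^sup>2 = Re (ip x x)"
  by (simp add: ip_norm_def ip_nonneg)

lemma ip_norm_eq_0_iff: "ip_norm ip x = 0 \<longleftrightarrow> x = 0"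
  using ip_pos[of x] by (cases "x = 0") (auto simp: ip_norm_def)

lemma ip_norm_minus: "ip_norm ip (- x) = ip_norm ip x"
  by (simp add: ip_norm_def ip_minus_left ip_minus_right)

lemma ip_norm_minus_commute: "ip_norm ip (x - y) = ip_norm ip (y - x)"
  by (metis ip_norm_minus minus_diff_eq)

lemma Cauchy_Schwarz: "cmod (ip x y) \<le> ip_norm ip x * ip_norm ip y"
proof (cases "y = 0")
  case False
  define a b where "a = Re (ip y y)" and "b = ip x y"
  have a: "0 < a" "ip y y = of_real a"
    using False ip_pos ip_self by (auto simp: a_def)
  have b: "ip y x = cnj b" "b * cnj b = of_real ((cmod b)\<^sup>2)"
    by (simp_all add: b_def ip_cnj_commute[of y x] complex_norm_square[symmetric])
  \<comment> \<open>\<open>z\<close> is \<open>a\<close> times the part of \<open>x\<close>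
    orthogonal to \<open>y\<close>; scaling by \<open>a\<close> avoids a division. Nonnegativity of
    \<open>ip z z\<close> is then the claim.\<close>
  define z where "z = smul (of_real a) x - smul b y"
  have "ip z z = of_real a * (of_real a * ip x x - b * cnj b)"
    by (simp add: z_def ip_diff_left ip_diff_right ip_scale_left ip_scale_right a b(1)
        algebra_simps flip: b_def)
  then have "Re (ip z z) = a * (a * Re (ip x x) - (cmod b)\<^sup>2)"
    unfolding b(2) by simp
  then have "0 \<le> a * (a * Re (ip x x) - (cmod b)\<^sup>2)"
    using ip_nonneg[of z] by simp
  then have "(cmod b)\<^sup>2 \<le> Re (ip x x) * a"
    using a(1) by (simp add: zero_le_mult_iff mult.commute)
  then have "(cmod (ip x y))\<^sup>2 \<le> (ip_norm ip x * ip_norm ip y)\<^sup>2"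
    by (simp add: b_def a_def power_mult_distrib ip_norm_power2)
  then show ?thesis
    by (rule power2_le_imp_le) simp
qed simp

lemma ip_norm_triangle: "ip_norm ip (x + y) \<le> ip_norm ip x + ip_norm ip y"
proof (rule power2_le_imp_le)
  have "Re (ip y x) = Re (ip x y)"
    by (simp add: ip_cnj_commute[of y x])
  then have "(ip_norm ip (x + y))\<^sup>2 = (ip_norm ip x)\<^sup>2 + 2 * Re (ip x y) + (ip_norm ip y)\<^sup>2"
    by (simp add: ip_norm_power2 ip_add_left ip_add_right)
  also have "Re (ip x y) \<le> ip_norm ip x * ip_norm ip y"
    using Cauchy_Schwarz[of x y] complex_Re_le_cmod order_trans by blast
  finally show "(ip_norm ip (x + y))\<^sup>2 \<le> (ip_norm ip x + ip_norm ip y)\<^sup>2"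
    by (simp add: power2_sum algebra_simps)
qed simp

lemma ip_norm_triangle_sub: "ip_norm ip x \<le> ip_norm ip y + ip_norm ip (x - y)"
  using ip_norm_triangle[of y "x - y"] by simp

lemma Metric_space_ip_dist: "Metric_space UNIV (ip_dist ip)"
proof
  fix x y z :: 'a
  show "ip_dist ip x z \<le> ip_dist ip x y + ip_dist ip y z"
    using ip_norm_triangle[of "x - y" "y - z"] by (simp add: ip_dist_def)
qed (auto simp: ip_dist_def ip_norm_eq_0_iff ip_norm_minus_commute)

lemma closure_of_approx:
  assumes "x \<in> Metric_space.mtopology UNIV (ip_dist ip) closure_of S" and "0 < e"
  obtains y where "y \<in> S" "ip_norm ip (x - y) < e"
  using assms Metric_space.metric_closure_of[OF Metric_space_ip_dist, of S]
  by (auto simp: Metric_space.in_mball[OF Metric_space_ip_dist] ip_dist_def)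

section \<open>Extension of frame bounds from a dense set\<close>

lemma L2_set_ip_triangle:
  "L2_set (\<lambda>n. cmod (ip x (g n))) F
     \<le> L2_set (\<lambda>n. cmod (ip y (g n))) F + L2_set (\<lambda>n. cmod (ip (x - y) (g n))) F"
proof -
  have "L2_set (\<lambda>n. cmod (ip x (g n))) F
      \<le> L2_set (\<lambda>n. cmod (ip y (g n)) + cmod (ip (x - y) (g n))) F"
  proof (rule L2_set_mono)
    fix n
    show "cmod (ip x (g n)) \<le> cmod (ip y (g n)) + cmod (ip (x - y) (g n))"
      using norm_triangle_ineq[of "ip y (g n)" "ip (x - y) (g n)"] by (simp add: ip_diff_left)
  qed simp
  also have "\<dots> \<le> L2_set (\<lambda>n. cmod (ip y (g n))) F + L2_set (\<lambda>n. cmod (ip (x - y) (g n))) F"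
    by (rule L2_set_triangle_ineq)
  finally show ?thesis .
qed

text \<open>The finite partial sums are continuous, which extends the upper bound; the lower bound then
  extends because the upper bound makes the analysis operator bounded into \<open>l\<^sup>2\<close>.\<close>

lemma hilbert_frame_dense:
  assumes hilbert: "hilbert_on smul ip UNIV" and AB: "0 < A" "A \<le> B"
    and dense: "\<And>x e. 0 < e \<Longrightarrow> \<exists>y\<in>V. ip_norm ip (x - y) < e"
    and summable: "\<And>x. x \<in> V \<Longrightarrow> (\<lambda>n. (cmod (ip x (g n)))\<^sup>2) summable_on UNIV"
    and lower: "\<And>x. x \<in> V \<Longrightarrow> A * (ip_norm ip x)\<^sup>2 \<le> (\<Sum>\<^sub>\<infinity>n. (cmod (ip x (g n)))\<^sup>2)"
    and upper: "\<And>x. x \<in> V \<Longrightarrow> (\<Sum>\<^sub>\<infinity>n. (cmod (ip x (g n)))\<^sup>2) \<le> B * (ip_norm ip x)\<^sup>2"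
  shows "hilbert_frame smul ip g A B"
proof -
  let ?N = "ip_norm ip" and ?L = "\<lambda>x. L2_set (\<lambda>n. cmod (ip x (g n)))"
    and ?S = "\<lambda>x. \<Sum>\<^sub>\<infinity>n. (cmod (ip x (g n)))\<^sup>2"
  have bound: "?L x F \<le> sqrt B * ?N x" if "finite F" for x F
  proof (rule field_le_epsilon)
    fix e :: real assume e: "0 < e"
    \<comment> \<open>\<open>C - 1\<close> collects the two errors made when \<open>y\<close>
      replaces \<open>x\<close>: \<open>sqrt B\<close> from the norm and the \<open>L2_set\<close>
      term from Cauchy-Schwarz. \<open>C\<close> may depend on \<open>F\<close>, since the resulting
      bound does not.\<close>
    define C where "C = 1 + sqrt B + L2_set (\<lambda>n. ?N (g n)) F"
    have C: "1 \<le> C"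
      using AB by (simp add: C_def L2_set_nonneg)
    then obtain y where y: "y \<in> V" "?N (x - y) < e / C"
      using dense[of "e / C" x] e by auto
    have "?L (x - y) F \<le> L2_set (\<lambda>n. ?N (x - y) * ?N (g n)) F"
      by (intro L2_set_mono Cauchy_Schwarz) simp
    then have 1: "?L (x - y) F \<le> ?N (x - y) * L2_set (\<lambda>n. ?N (g n)) F"
      by (simp add: L2_set_right_distrib)
    have "?L y F \<le> sqrt (?S y)"
      by (rule L2_set_le_sqrt_infsum[OF summable[OF y(1)] that])
    also have "\<dots> \<le> sqrt (B * (?N y)\<^sup>2)"
      using upper[OF y(1)] by simp
    also have "\<dots> = sqrt B * ?N y"
      by (simp add: real_sqrt_mult)
    also have "\<dots> \<le> sqrt B * (?N x + ?N (x - y))"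
      using ip_norm_triangle_sub[of y x] AB by (simp add: ip_norm_minus_commute[of y x])
    finally have "?L x F \<le> sqrt B * ?N x + ?N (x - y) * (C - 1)"
      using L2_set_ip_triangle[of x g F y] 1 by (simp add: C_def algebra_simps)
    also have "?N (x - y) * (C - 1) \<le> ?N (x - y) * C"
      by (simp add: mult_left_mono)
    also have "?N (x - y) * C \<le> e"
      using y(2) C by (simp add: pos_less_divide_eq)
    finally show "?L x F \<le> sqrt B * ?N x + e"
      by simp
  qed
  note summable' = summable_on_L2_set_bound(1)[OF bound]
  have up: "?S x \<le> B * (?N x)\<^sup>2" for x
    using summable_on_L2_set_bound(2)[OF bound, of x] AB by (simp add: power_mult_distrib)
  have "sqrt A * ?N x \<le> sqrt (?S x)" for x
  proof (rule field_le_epsilon)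
    fix e :: real assume e: "0 < e"
    \<comment> \<open>Here \<open>sqrt A\<close> pays for replacing the norm of \<open>x\<close> by
      that of \<open>y\<close>, and \<open>sqrt B\<close> for the change in the
      coefficients.\<close>
    define C where "C = sqrt A + sqrt B"
    have C: "0 < C"
      using AB by (simp add: C_def add_pos_pos)
    then obtain y where y: "y \<in> V" "?N (x - y) < e / C"
      using dense[of "e / C" x] e by auto
    \<comment> \<open>The coefficients of \<open>y\<close> differ from those of \<open>x\<close> by
      those of \<open>y - x\<close>, and \<open>bound\<close> controls these although
      \<open>y - x\<close> need not lie in \<open>V\<close>. The estimate is uniform in
      \<open>F\<close>, so it passes to the infinite sum.\<close>
    have "?L y F \<le> sqrt (?S x) + sqrt B * ?N (x - y)" if "finite F" for F
      using L2_set_ip_triangle[of y g F x] L2_set_le_sqrt_infsum[OF summable'[of x] that]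
        bound[OF that, of "y - x"]
      by (simp add: ip_norm_minus_commute[of y x])
    then have "?S y \<le> (sqrt (?S x) + sqrt B * ?N (x - y))\<^sup>2"
      by (rule summable_on_L2_set_bound(2))
    then have "sqrt (?S y) \<le> sqrt (?S x) + sqrt B * ?N (x - y)"
      using AB by (intro real_le_lsqrt) (auto simp: infsum_nonneg)
    moreover have "sqrt A * ?N y \<le> sqrt (?S y)"
      using lower[OF y(1)] AB by (intro real_le_rsqrt) (simp add: power_mult_distrib)
    moreover have "sqrt A * ?N x \<le> sqrt A * ?N y + sqrt A * ?N (x - y)"
      using ip_norm_triangle_sub[of x y] AB by (simp flip: distrib_left)
    moreover have "C * ?N (x - y) \<le> e"
      using y(2) C by (simp add: pos_less_divide_eq mult.commute)
    ultimately show "sqrt A * ?N x \<le> sqrt (?S x) + e"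
      by (simp add: C_def algebra_simps)
  qed
  then have low: "A * (?N x)\<^sup>2 \<le> ?S x" for x
    using power_mono[of "sqrt A * ?N x" "sqrt (?S x)" 2] AB
    by (simp add: power_mult_distrib infsum_nonneg)
  show ?thesis
    unfolding hilbert_frame_def using hilbert AB summable' low up by blast
qed

end

section \<open>The fundamental symmetry and its Hilbert inner product\<close>

context krein_space
begin

lemma subspace_Hp: "subspace Hp" and subspace_Hm: "subspace Hm"
  using hilbert_Hp hilbert_Hm by (auto simp: hilbert_on_def)

lemma decompose:
  obtains p m where "p \<in> Hp" "m \<in> Hm" "x = p + m"
  using decomposition(1) unfolding direct_sum_def by blast

lemma J_eq:
  assumes "p \<in> Hp" "m \<in> Hm"
  shows "J (p + m) = p - m"
  using component_eq[OF subspace_Hp subspace_Hm decomposition(2) assms]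
    component_eq[OF subspace_Hm subspace_Hp _ assms(2,1)] decomposition(2)
  by (simp add: J_def Int_commute add.commute)

text \<open>The cross terms vanish by orthogonality of \<open>Hp\<close> and \<open>Hm\<close>, and
  \<open>J\<close> flips the sign of the \<open>Hm\<close> term.\<close>

lemma ipJ_eq:
  assumes "p \<in> Hp" "m \<in> Hm" "p' \<in> Hp" "m' \<in> Hm"
  shows "ipJ (p + m) (p' + m') = ip p p' - ip m m'"
proof -
  have "ip m p' = 0"
    using orthogonal[OF assms(3,2)] by (simp add: ip_cnj_commute[of m p'])
  then show ?thesis
    using assms by (simp add: ipJ_def J_eq ip_diff_left ip_add_right orthogonal)
qed

text \<open>\<open>J\<close> is made of definite descriptions, so additivity is obtained by
  regrouping the sum into its \<open>Hp\<close> and \<open>Hm\<close> parts and applying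
  \<open>J_eq\<close>.\<close>

lemma J_add: "J (x + y) = J x + J y"
proof -
  obtain p m q l where x: "p \<in> Hp" "m \<in> Hm" "x = p + m" and y: "q \<in> Hp" "l \<in> Hm" "y = q + l"
    by (metis decompose)
  have "J (x + y) = J ((p + q) + (m + l))"
    using x y by (simp add: algebra_simps)
  also have "\<dots> = J x + J y"
    using x y by (simp add: J_eq subspace_add[OF subspace_Hp] subspace_add[OF subspace_Hm])
  finally show ?thesis .
qed

lemma J_scale: "J (smul c x) = smul c (J x)"
proof -
  obtain p m where x: "p \<in> Hp" "m \<in> Hm" "x = p + m"
    by (metis decompose)
  then show ?thesis
    by (simp add: J_eq subspace_scale[OF subspace_Hp] subspace_scale[OF subspace_Hm]
        scale_right_distrib scale_right_diff_distrib)
qed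

lemma ip_Hp_pos: "x \<in> Hp \<Longrightarrow> x \<noteq> 0 \<Longrightarrow> 0 < Re (ip x x)"
  and ip_Hm_neg: "x \<in> Hm \<Longrightarrow> x \<noteq> 0 \<Longrightarrow> Re (ip x x) < 0"
  using hilbert_Hp hilbert_Hm by (auto simp: hilbert_on_def)

lemma ip_Hp_nonneg: "x \<in> Hp \<Longrightarrow> 0 \<le> Re (ip x x)"
  and ip_Hm_nonpos: "x \<in> Hm \<Longrightarrow> Re (ip x x) \<le> 0"
  using ip_Hp_pos[of x] ip_Hm_neg[of x] by (cases "x = 0"; force)+

text \<open>Definiteness holds because both terms of \<open>ipJ x x\<close> are nonnegative and a
  nonzero \<open>x\<close> has a nonzero component. The instance makes the metric and closure facts
  available for \<open>topJ\<close>.\<close>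

sublocale J: definite_hermitian_space smul ipJ
proof
  fix x y z :: 'a and c :: complex
  show "ipJ (x + y) z = ipJ x z + ipJ y z"
    by (simp add: ipJ_def J_add ip_add_left)
  show "ipJ (smul c x) y = c * ipJ x y"
    by (simp add: ipJ_def J_scale ip_scale_left)
  obtain p m q l where x: "p \<in> Hp" "m \<in> Hm" "x = p + m" and y: "q \<in> Hp" "l \<in> Hm" "y = q + l"
    by (metis decompose)
  show "ipJ y x = cnj (ipJ x y)"
    using x y by (simp add: ipJ_eq ip_cnj_commute[of q p] ip_cnj_commute[of l m])
  assume "x \<noteq> 0"
  then have "p \<noteq> 0 \<or> m \<noteq> 0"
    using x by auto
  then show "0 < Re (ipJ x x)"
    using x ip_Hp_pos[of p] ip_Hm_neg[of m] ip_Hp_nonneg[of p] ip_Hm_nonpos[of m]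
    by (auto simp: ipJ_eq)
qed

text \<open>\<open>ip x x\<close> is the difference of the two nonnegative numbers
  \<open>ip p p\<close> and \<open>- ip m m\<close>, whose sum is the squared norm.\<close>

lemma abs_ip_le_ipJ: "\<bar>Re (ip x x)\<bar> \<le> (ip_norm ipJ x)\<^sup>2"
proof -
  obtain p m where x: "p \<in> Hp" "m \<in> Hm" "x = p + m"
    by (metis decompose)
  have "ip m p = 0"
    using orthogonal[OF x(1,2)] by (simp add: ip_cnj_commute[of m p])
  then have "ip x x = ip p p + ip m m"
    using x by (simp add: ip_add_left ip_add_right orthogonal)
  then show ?thesis
    using x ip_Hp_nonneg[of p] ip_Hm_nonpos[of m] by (simp add: J.ip_norm_power2 ipJ_eq)
qed

lemma Np_Un_Nm: "Np f \<union> Nm f = UNIV" and Np_Int_Nm: "Np f \<inter> Nm f = {}"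
  by (auto simp: Np_def Nm_def)

lemma span_subset_Mp: "span (f ` Np f) \<subseteq> Mp f" and span_subset_Mm: "span (f ` Nm f) \<subseteq> Mm f"
  by (simp_all add: Mp_def Mm_def topJ_def closure_of_subset
      Metric_space.topspace_mtopology[OF J.Metric_space_ip_dist])

section \<open>The subspaces of a J-frame and the form \<open>ip1\<close>\<close>

context
  fixes f :: "nat \<Rightarrow> 'a" and A B :: real
  assumes J_frame: "J_frame f A B"
begin

lemma subspace_Mp: "subspace (Mp f)" and subspace_Mm: "subspace (Mm f)"
  and ip_Mp_pos: "\<And>x. x \<in> Mp f \<Longrightarrow> x \<noteq> 0 \<Longrightarrow> 0 < Re (ip x x)"
  and ip_Mm_neg: "\<And>x. x \<in> Mm f \<Longrightarrow> x \<noteq> 0 \<Longrightarrow> Re (ip x x) < 0"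
  using J_frame
  by (auto simp: J_frame_def maximal_positive_def maximal_negative_def positive_def negative_def
      closed_subspace_def)

text \<open>The J-frame inequalities involve the modulus of \<open>ip x x\<close>; on
  \<open>Mp\<close> and \<open>Mm\<close> it is exactly the signed term from which
  \<open>ip1\<close> is built.\<close>

lemma ip_Mp: "x \<in> Mp f \<Longrightarrow> cmod (ip x x) = Re (ip x x)"
  and ip_Mm: "x \<in> Mm f \<Longrightarrow> cmod (ip x x) = - Re (ip x x)"
  using ip_Mp_pos[of x] ip_Mm_neg[of x] by (cases "x = 0"; simp add: cmod_ip_self)+

text \<open>A nonzero common vector would have \<open>ip x x\<close> both positive and negative.
  This makes the components in \<open>ip1\<close> unique.\<close>

lemma Mp_Int_Mm: "Mp f \<inter> Mm f = {0}"
proof -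
  have "x = 0" if "x \<in> Mp f" "x \<in> Mm f" for x
    using ip_Mp_pos[OF that(1)] ip_Mm_neg[OF that(2)] by force
  then show ?thesis
    using subspace_0[OF subspace_Mp] subspace_0[OF subspace_Mm] by blast
qed

text \<open>In contrast to \<open>ipJ_eq\<close>, no orthogonality enters: \<open>ip1\<close> has no
  cross terms by definition, so uniqueness of components suffices.\<close>

lemma ip1_eq:
  assumes "p \<in> Mp f" "m \<in> Mm f" "p' \<in> Mp f" "m' \<in> Mm f"
  shows "ip1 f (p + m) (p' + m') = ip p p' - ip m m'"
proof -
  have "component (Mp f) (Mm f) (u + v) = u" "component (Mm f) (Mp f) (u + v) = v"
    if "u \<in> Mp f" "v \<in> Mm f" for u v
    using component_eq[OF subspace_Mp subspace_Mm Mp_Int_Mm that]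
      component_eq[OF subspace_Mm subspace_Mp _ that(2,1)] Mp_Int_Mm
    by (simp_all add: Int_commute add.commute)
  then show ?thesis
    using assms by (simp add: ip1_def)
qed

text \<open>For \<open>n\<close> in \<open>Np f\<close> the vector \<open>f n\<close> has
  \<open>Mm\<close> component 0, so only the \<open>Mp\<close> term survives. The mirrored case for
  \<open>Nm f\<close> carries a sign that disappears under the modulus.\<close>

lemma ip1_Np:
  assumes "p \<in> Mp f" "m \<in> Mm f" "n \<in> Np f"
  shows "ip1 f (p + m) (f n) = ip p (f n)"
proof -
  have "f n \<in> Mp f"
    using assms(3) span_subset_Mp span_base by blast
  then show ?thesis
    using ip1_eq[OF assms(1,2) _ subspace_0[OF subspace_Mm], of "f n"] by simp
qed

lemma ip1_Nm:
  assumes "p \<in> Mp f" "m \<in> Mm f" "n \<in> Nm f"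
  shows "ip1 f (p + m) (f n) = - ip m (f n)"
proof -
  have "f n \<in> Mm f"
    using assms(3) span_subset_Mm span_base by blast
  then show ?thesis
    using ip1_eq[OF assms(1,2) subspace_0[OF subspace_Mp], of "f n"] by simp
qed

text \<open>Needed because \<open>emb\<close> is known to preserve the form only on
  \<open>D f\<close>.\<close>

lemma frame_in_D: "f n \<in> D f"
proof -
  have "f n \<in> Mp f \<or> f n \<in> Mm f"
    using Np_Un_Nm[of f] span_subset_Mp[of f] span_subset_Mm[of f] span_base by blast
  then show ?thesis
    unfolding D_def direct_sum_def
    using subspace_0[OF subspace_Mp] subspace_0[OF subspace_Mm] by force
qed

section \<open>Frame bounds and density for the sum of the two spans\<close>

lemma ip1_frame_span:
  assumes "x \<in> direct_sum (span (f ` Np f)) (span (f ` Nm f))"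
  shows "(\<lambda>n. (cmod (ip1 f x (f n)))\<^sup>2) summable_on UNIV"
    and "A * Re (ip1 f x x) \<le> (\<Sum>\<^sub>\<infinity>n. (cmod (ip1 f x (f n)))\<^sup>2)"
    and "(\<Sum>\<^sub>\<infinity>n. (cmod (ip1 f x (f n)))\<^sup>2) \<le> B * Re (ip1 f x x)"
proof -
  obtain p m where p: "p \<in> span (f ` Np f)" and m: "m \<in> span (f ` Nm f)" and x: "x = p + m"
    using assms by (auto simp: direct_sum_def)
  have M: "p \<in> Mp f" "m \<in> Mm f"
    using p m span_subset_Mp span_subset_Mm by auto
  let ?g = "\<lambda>n. (cmod (ip1 f x (f n)))\<^sup>2"
  let ?Sp = "\<Sum>\<^sub>\<infinity>n\<in>Np f. (cmod (ip p (f n)))\<^sup>2" and ?Sm = "\<Sum>\<^sub>\<infinity>n\<in>Nm f. (cmod (ip m (f n)))\<^sup>2"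
  have g: "?g n = (cmod (ip p (f n)))\<^sup>2" if "n \<in> Np f" for n
    using that by (simp add: x ip1_Np[OF M])
  have h: "?g n = (cmod (ip m (f n)))\<^sup>2" if "n \<in> Nm f" for n
    using that by (simp add: x ip1_Nm[OF M])
  have P: "(\<lambda>n. (cmod (ip p (f n)))\<^sup>2) summable_on Np f"
    "A * cmod (ip p p) \<le> ?Sp" "?Sp \<le> B * cmod (ip p p)"
    and N: "(\<lambda>n. (cmod (ip m (f n)))\<^sup>2) summable_on Nm f"
    "A * cmod (ip m m) \<le> ?Sm" "?Sm \<le> B * cmod (ip m m)"
    using J_frame p m by (auto simp: J_frame_def)
  have s: "?g summable_on Np f" "?g summable_on Nm f"
    using P(1) N(1) g h by (simp_all cong: summable_on_cong)
  show "?g summable_on UNIV"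
    using summable_on_Un_disjoint[OF s Np_Int_Nm] by (simp add: Np_Un_Nm)
  have S: "infsum ?g UNIV = ?Sp + ?Sm"
    using infsum_Un_disjoint[OF s Np_Int_Nm, unfolded Np_Un_Nm] g h by (simp cong: infsum_cong)
  \<comment> \<open>The squared norm splits along the same two parts as the coefficient sum, so the
    two J-frame inequalities can be added with the same \<open>A\<close> and
    \<open>B\<close>.\<close>
  have "Re (ip1 f x x) = cmod (ip p p) + cmod (ip m m)"
    using M by (simp add: x ip1_eq ip_Mp ip_Mm)
  then show "A * Re (ip1 f x x) \<le> infsum ?g UNIV" "infsum ?g UNIV \<le> B * Re (ip1 f x x)"
    using P N S by (simp_all add: distrib_left)
qed

text \<open>Density survives the passage from \<open>\<parallel>\<cdot>\<parallel>\<close> to \<open>\<parallel>\<cdot>\<parallel>\<^sub>1\<close> because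
  \<open>\<bar>[x, x]\<bar> \<le> \<parallel>x\<parallel>\<^sup>2\<close>.\<close>

lemma span_dense_in_D:
  assumes "x \<in> D f" "0 < e"
  obtains y where "y \<in> direct_sum (span (f ` Np f)) (span (f ` Nm f))"
    and "Re (ip1 f (x - y) (x - y)) < e"
proof -
  obtain p m where p: "p \<in> Mp f" and m: "m \<in> Mm f" and x: "x = p + m"
    using assms(1) by (auto simp: D_def direct_sum_def)
  \<comment> \<open>\<open>e\<close> bounds a squared norm, and each of the two components may
    contribute at most \<open>e / 2\<close> to it.\<close>
  have e: "0 < sqrt (e / 2)"
    using assms(2) by simp
  obtain q where q: "q \<in> span (f ` Np f)" "ip_norm ipJ (p - q) < sqrt (e / 2)"
    using J.closure_of_approx[OF p[unfolded Mp_def topJ_def] e] .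
  obtain l where l: "l \<in> span (f ` Nm f)" "ip_norm ipJ (m - l) < sqrt (e / 2)"
    using J.closure_of_approx[OF m[unfolded Mm_def topJ_def] e] .
  have small: "\<bar>Re (ip z z)\<bar> < e / 2" if "ip_norm ipJ z < sqrt (e / 2)" for z
    using abs_ip_le_ipJ[of z] power_strict_mono[OF that, of 2] assms(2) by simp
  have M: "p - q \<in> Mp f" "m - l \<in> Mm f"
    using p m q l span_subset_Mp span_subset_Mm subspace_diff[OF subspace_Mp]
      subspace_diff[OF subspace_Mm] by blast+
  have eq: "x - (q + l) = (p - q) + (m - l)"
    by (simp add: x)
  have "Re (ip1 f (x - (q + l)) (x - (q + l)))
      = Re (ip (p - q) (p - q)) - Re (ip (m - l) (m - l))"
    unfolding eq ip1_eq[OF M M] by simp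
  also have "\<dots> < e"
    using small[OF q(2)] small[OF l(2)] by linarith
  finally show thesis
    using that q l by (force simp: direct_sum_def)
qed

section \<open>Passage to the Hilbert completion\<close>

lemma hilbert_frame_completion:
  assumes "hilbert_completion smul (D f) (ip1 f) smulH ipH emb"
  shows "hilbert_frame smulH ipH (\<lambda>n. emb (f n)) A B"
proof -
  have hilbert: "hilbert_on smulH ipH UNIV"
    and emb_add: "\<And>x y. x \<in> D f \<Longrightarrow> y \<in> D f \<Longrightarrow> emb (x + y) = emb x + emb y"
    and emb_ip: "\<And>x y. x \<in> D f \<Longrightarrow> y \<in> D f \<Longrightarrow> ipH (emb x) (emb y) = ip1 f x y"
    and emb_dense: "\<And>z. z \<in> Metric_space.mtopology UNIV (ip_dist ipH) closure_of (emb ` D f)"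
    using assms unfolding hilbert_completion_def by auto
  interpret H: definite_hermitian_space smulH ipH
    using hilbert unfolding hilbert_on_def definite_hermitian_space_def
      definite_hermitian_space_axioms_def by auto
  let ?V = "direct_sum (span (f ` Np f)) (span (f ` Nm f))"
  have V: "?V \<subseteq> D f"
    using span_subset_Mp span_subset_Mm unfolding D_def direct_sum_def by blast
  have subspace_D: "subspace (D f)"
    unfolding D_def by (rule subspace_direct_sum[OF subspace_Mp subspace_Mm])
  \<comment> \<open>Only additivity on \<open>D f\<close> is given for \<open>emb\<close>; it is
    applied to \<open>x - y\<close> and \<open>y\<close>, both in \<open>D f\<close>.\<close>
  have emb_diff: "emb (x - y) = emb x - emb y" if "x \<in> D f" "y \<in> D f" for x y
    using emb_add[of "x - y" y] that subspace_diff[OF subspace_D] by simp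
  have emb_norm: "(ip_norm ipH (emb x))\<^sup>2 = Re (ip1 f x x)" if "x \<in> D f" for x
    using that by (simp add: H.ip_norm_power2 emb_ip)
  show ?thesis
  proof (rule H.hilbert_frame_dense[where V = "emb ` ?V"])
    show "hilbert_on smulH ipH UNIV" "0 < A" "A \<le> B"
      using hilbert J_frame by (simp_all add: J_frame_def)
  next
    fix z and e :: real assume e: "0 < e"
    obtain x where x: "x \<in> D f" "ip_norm ipH (z - emb x) < e / 2"
      using H.closure_of_approx[OF emb_dense, of "e / 2" z] e by auto
    obtain y where y: "y \<in> ?V" "Re (ip1 f (x - y) (x - y)) < (e / 2)\<^sup>2"
      using span_dense_in_D[OF x(1), of "(e / 2)\<^sup>2"] e by auto
    have "y \<in> D f" "x - y \<in> D f"
      using x(1) y(1) V subspace_diff[OF subspace_D] by blast+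
    then have "(ip_norm ipH (emb x - emb y))\<^sup>2 < (e / 2)\<^sup>2"
      using y(2) emb_norm[of "x - y"] emb_diff[OF x(1)] by simp
    then have "ip_norm ipH (emb x - emb y) < e / 2"
      using e by (intro power2_less_imp_less[of _ "e / 2"]) auto
    then have "ip_norm ipH (z - emb y) < e"
      using H.ip_norm_triangle[of "z - emb x" "emb x - emb y"] x(2) by simp
    then show "\<exists>w\<in>emb ` ?V. ip_norm ipH (z - w) < e"
      using y(1) by blast
  next
    fix z assume "z \<in> emb ` ?V"
    then obtain x where x: "x \<in> ?V" "z = emb x"
      by blast
    then have "x \<in> D f"
      using V by blast
    then have eq: "ipH z (emb (f n)) = ip1 f x (f n)" "(ip_norm ipH z)\<^sup>2 = Re (ip1 f x x)" for n
      by (simp_all add: x(2) emb_ip emb_norm frame_in_D)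
    show "(\<lambda>n. (cmod (ipH z (emb (f n))))\<^sup>2) summable_on UNIV"
      "A * (ip_norm ipH z)\<^sup>2 \<le> (\<Sum>\<^sub>\<infinity>n. (cmod (ipH z (emb (f n))))\<^sup>2)"
      "(\<Sum>\<^sub>\<infinity>n. (cmod (ipH z (emb (f n))))\<^sup>2) \<le> B * (ip_norm ipH z)\<^sup>2"
      unfolding eq using ip1_frame_span[OF x(1)] by simp_all
  qed
qed

end

end

theorem proposition3p4:
  fixes smul :: "complex \<Rightarrow> 'a::ab_group_add \<Rightarrow> 'a"
    and ip :: "'a \<Rightarrow> 'a \<Rightarrow> complex"
    and Hp Hm :: "'a set"
    and f :: "nat \<Rightarrow> 'a"
    and A B :: real
    and smulH :: "complex \<Rightarrow> 'b::ab_group_add \<Rightarrow> 'b"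
    and ipH :: "'b \<Rightarrow> 'b \<Rightarrow> complex"
    and emb :: "'a \<Rightarrow> 'b"
  assumes "krein_space smul ip Hp Hm"
    and "krein_space.J_frame smul ip Hp Hm f A B"
    and "krein_space.D smul ip Hp Hm f \<noteq> UNIV"
    and "hilbert_completion smul (krein_space.D smul ip Hp Hm f)
           (krein_space.ip1 smul ip Hp Hm f) smulH ipH emb"
  shows "hilbert_frame smulH ipH (\<lambda>n. emb (f n)) A B"
  by (rule krein_space.hilbert_frame_completion[OF assms(1,2,4)])

end
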